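(* Assume $\mathcal{D}\cap\mathcal{T}=\emptyset$, $\mathcal{D}\cap\mathcal{B}=\emptyset$ and $\mathcal{T}\cap\mathcal{C}=\emptyset$, and let $\mathcal{Z}^\circ(\mathcal{B})$ be computed from the initialization $\mathcal{Z}_0=\mathcal{V}\setminus\mathcal{T}$. If $\mathcal{Z}\subseteq\mathcal{V}$ is an $(A,B)$-invariant set of nodes, with basis matrix $Z$, then a friend of $\mathcal{Z}$ solving the DDPSF is $F=UZ^\top+F_q$, where $U$ is such that $AZ=ZX+BU$ holds for some matrix $X$, and $F_q=M(Z^\perp)^\top$ with $M$ an $m\times(n-|\mathcal{Z}|)$ matrix of coefficients. Furthermore, if $\mathcal{B}$ is a set of input nodes such that $\mathcal{B}=\partial_+(\mathcal{Z}^\circ(\mathcal{B}),A)$, then $F=B^\top A+F_q$ is the unique friend of $\mathcal{Z}=\mathcal{Z}^\circ(\mathcal{B})$, up to $F_q=M(Z^\perp)^\top$.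
   Context: Let $(\mathcal{V},\mathcal{E},A)$ be a digraph with $\mathcal{V}=\{v_1,\dots,v_n\}$, where $(v_i,v_j)\in\mathcal{E}$ means $v_i\to v_j$, and $A\in\mathbb{R}^{n\times n}$ has $A_{ji}\ne0$ if and only if $(v_i,v_j)\in\mathcal{E}$. $\mathcal{B},\mathcal{C},\mathcal{D},\mathcal{T}\subseteq\mathcal{V}$ are the sets of input, output, disturbance and target nodes of the system $\dot x=Ax+Bu+Dw$, $y=Cx$, $z=Tx$, and $m=|\mathcal{B}|$. The columns of $B$ (resp. $D$) are the canonical vectors $e_i$ with $v_i\in\mathcal{B}$ (resp. $v_i\in\mathcal{D}$); the rows of $C$ (resp. $T$) are the $e_i^\top$ with $v_i\in\mathcal{C}$ (resp. $v_i\in\mathcal{T}$). A node set is identified with the subspace of $\mathbb{R}^n$ spanned by the corresponding canonical vectors. The basis matrix $Z$ of a node set $\mathcal{Z}$ has as columns the $e_i$ with $v_i\in\mathcal{Z}$; $Z^\perp$ denotes a basis matrix of $\mathcal{Z}^\perp=\mathcal{V}\setminus\mathcal{Z}$. $\mathcal{Z}$ is $(A,B)$-invariant (controlled invariant) if $A\mathcal{Z}\subseteq\mathcal{Z}+\mathcal{B}$. A friend of $\mathcal{Z}$ is a matrix $F\in\mathbb{R}^{m\times n}$ with $(A-BF)\mathcal{Z}\subseteq\mathcal{Z}$. The DDPSF is the disturbance decoupling problem by state feedback: find $u=-Fx$ such that the target vector $z(t)$ does not depend on the disturbance $w(t)$ for all $t\ge0$, equivalently such that $T(sI-A+BF)^{-1}D=0$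 for all $s$. $\mathcal{Z}^\circ(\mathcal{B})$ is the (stationary) limit of the recursion $\mathcal{Z}_0=\mathcal{V}\setminus\mathcal{T}$, $\mathcal{Z}_{k+1}=\mathcal{Z}_k\setminus\{v_i\in\mathcal{Z}_k:\exists\,(v_i,v_j)\in\mathcal{E}\text{ with }v_j\notin\mathcal{Z}_k\cup\mathcal{B}\}$, i.e. the maximal $(A,B)$-invariant set of nodes contained in $\mathcal{V}\setminus\mathcal{T}$. The out-boundary of $\mathcal{W}\subseteq\mathcal{V}$ is $\partial_+(\mathcal{W},A)=\{v_j\in\mathcal{V}\setminus\mathcal{W}:\exists\,(v_i,v_j)\in\mathcal{E},\ v_i\in\mathcal{W}\}$.
   Formalization: That F solves the DDPSF is claimed only for invariant Z with D ⊆ Z ⊆ V∖T; for other invariant Z (e.g. Z empty, with an edge from a disturbance node to a target that no input can affect) it is false. That F is a friend holds for every invariant Z. *)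

theory Defs
  imports "HOL-Analysis.Analysis" "Jordan_Normal_Form.VS_Connect"
begin

unbundle no vec_syntax
unbundle no inner_syntax

text \<open>
  Nodes are the numbers \<open>0, \<dots>, n - 1\<close>, and node sets are subsets of \<open>{..<n}\<close>.  Matrices are
  those of \<open>Jordan_Normal_Form\<close>, whose dimensions are terms: they depend on the cardinalities of
  node sets, some of which may be empty.
\<close>

definition weighted_digraph :: "nat \<Rightarrow> (nat \<times> nat) set \<Rightarrow> real mat \<Rightarrow> bool" where
  "weighted_digraph n \<E> A \<longleftrightarrow>
     \<E> \<subseteq> {..<n} \<times> {..<n} \<and> A \<in> carrier_mat n n \<and>
     (\<forall>i<n. \<forall>j<n. A $$ (j, i) \<noteq> 0 \<longleftrightarrow> (i, j) \<in> \<E>)"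

text \<open>The columns of the basis matrix are taken in increasing order of the nodes.\<close>

definition basis_matrix :: "nat \<Rightarrow> nat set \<Rightarrow> real mat" where
  "basis_matrix n \<Z> = mat_of_cols n (map (unit_vec n) (sorted_list_of_set \<Z>))"

definition node_space :: "nat \<Rightarrow> nat set \<Rightarrow> real vec set" where
  "node_space n \<Z> =
     LinearCombinations.module.span class_ring (module_vec TYPE(real) n) (unit_vec n ` \<Z>)"

definition controlled_invariant :: "nat \<Rightarrow> real mat \<Rightarrow> nat set \<Rightarrow> nat set \<Rightarrow> bool" where
  "controlled_invariant n A \<B> \<Z> \<longleftrightarrow>
     (\<lambda>v. A *\<^sub>v v) ` node_space n \<Z> \<subseteq> {z + b |z b. z \<in> node_space n \<Z> \<and> b \<in> node_space n \<B>}"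

definition friend :: "nat \<Rightarrow> real mat \<Rightarrow> nat set \<Rightarrow> nat set \<Rightarrow> real mat \<Rightarrow> bool" where
  "friend n A \<B> \<Z> F \<longleftrightarrow>
     F \<in> carrier_mat (card \<B>) n \<and>
     (\<lambda>v. (A - basis_matrix n \<B> * F) *\<^sub>v v) ` node_space n \<Z> \<subseteq> node_space n \<Z>"

text \<open>
  The equation \<open>x' = A x + B u + D w\<close> on \<open>t \<ge> 0\<close>, in integrated form and componentwise.  The
  integrated form covers the differentiable solutions and also admits discontinuous disturbances.
\<close>

definition trajectory ::
  "real mat \<Rightarrow> real mat \<Rightarrow> real mat \<Rightarrow> (real \<Rightarrow> real vec) \<Rightarrow> (real \<Rightarrow> real vec) \<Rightarrow> (real \<Rightarrow> real vec) \<Rightarrow> bool"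
  where
  "trajectory A B D x u w \<longleftrightarrow>
     (\<forall>t\<ge>0. x t \<in> carrier_vec (dim_row A) \<and>
        (\<forall>i<dim_row A.
           ((\<lambda>s. (A *\<^sub>v x s + B *\<^sub>v u s + D *\<^sub>v w s) $ i) has_integral (x t $ i - x 0 $ i)) {0..t}))"

text \<open>
  Under the feedback \<open>u = - F x\<close>, the target \<open>z = T x\<close> is the same for any two disturbances, given
  the same initial state.
\<close>

definition solves_DDPSF :: "real mat \<Rightarrow> real mat \<Rightarrow> real mat \<Rightarrow> real mat \<Rightarrow> real mat \<Rightarrow> bool" where
  "solves_DDPSF A B D T F \<longleftrightarrow>
     (\<forall>w\<^sub>1 w\<^sub>2 x\<^sub>1 x\<^sub>2.
        (\<forall>t\<ge>0. w\<^sub>1 t \<in> carrier_vec (dim_col D) \<and> w\<^sub>2 t \<in> carrier_vec (dim_col D)) \<longrightarrow>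
        trajectory A B D x\<^sub>1 (\<lambda>t. - (F *\<^sub>v x\<^sub>1 t)) w\<^sub>1 \<longrightarrow>
        trajectory A B D x\<^sub>2 (\<lambda>t. - (F *\<^sub>v x\<^sub>2 t)) w\<^sub>2 \<longrightarrow>
        x\<^sub>1 0 = x\<^sub>2 0 \<longrightarrow>
        (\<forall>t\<ge>0. T *\<^sub>v x\<^sub>1 t = T *\<^sub>v x\<^sub>2 t))"

text \<open>
  The frequency-domain form \<open>T (s I - A + B F)\<^sup>-\<^sup>1 D = 0\<close>, for all complex \<open>s\<close> at which the inverse
  \<open>R\<close> exists.
\<close>

definition solves_DDPSF_freq :: "real mat \<Rightarrow> real mat \<Rightarrow> real mat \<Rightarrow> real mat \<Rightarrow> real mat \<Rightarrow> bool" where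
  "solves_DDPSF_freq A B D T F \<longleftrightarrow>
     (\<forall>s::complex. \<forall>R\<in>carrier_mat (dim_row A) (dim_row A).
        (let P = s \<cdot>\<^sub>m 1\<^sub>m (dim_row A) - map_mat complex_of_real A + map_mat complex_of_real (B * F)
         in inverts_mat P R \<and> inverts_mat R P) \<longrightarrow>
        map_mat complex_of_real T * R * map_mat complex_of_real D = 0\<^sub>m (dim_row T) (dim_col D))"

primrec invariant_iter ::
  "nat \<Rightarrow> (nat \<times> nat) set \<Rightarrow> nat set \<Rightarrow> nat set \<Rightarrow> nat \<Rightarrow> nat set" where
  "invariant_iter n \<E> \<T> \<B> 0 = {..<n} - \<T>"
| "invariant_iter n \<E> \<T> \<B> (Suc k) =
     invariant_iter n \<E> \<T> \<B> k -
       {i \<in> invariant_iter n \<E> \<T> \<B> k. \<exists>j. (i, j) \<in> \<E> \<and> j \<notin> invariant_iter n \<E> \<T> \<B> k \<union> \<B>}"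

definition max_invariant ::
  "nat \<Rightarrow> (nat \<times> nat) set \<Rightarrow> nat set \<Rightarrow> nat set \<Rightarrow> nat set" where
  "max_invariant n \<E> \<T> \<B> = (\<Inter>k. invariant_iter n \<E> \<T> \<B> k)"

text \<open>The intersection is the stationary value of the decreasing recursion.\<close>

lemma eventually_invariant_iter_eq_max_invariant:
  "\<forall>\<^sub>F k in sequentially. invariant_iter n \<E> \<T> \<B> k = max_invariant n \<E> \<T> \<B>"
proof -
  let ?Z = "invariant_iter n \<E> \<T> \<B>"
  have anti: "?Z l \<subseteq> ?Z k" if "k \<le> l" for k l
    using that by (induction rule: dec_induct) auto
  have fin: "finite (?Z k)" for k
    using anti[of 0 k] by (auto intro: finite_subset[of _ "{..<n}"])
  obtain N where N: "\<And>k. card (?Z N) \<le> card (?Z k)"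
    using ex_has_least_nat[of "\<lambda>_. True" 0 "\<lambda>k. card (?Z k)"] by auto
  have eq: "?Z k = ?Z N" if "N \<le> k" for k
    using card_subset_eq[OF fin anti[OF that]] N[of k] card_mono[OF fin anti[OF that]]
    by fastforce
  have "?Z N \<subseteq> ?Z k" for k
    using eq[of k] anti[of k N] by (cases "N \<le> k") auto
  then have "max_invariant n \<E> \<T> \<B> = ?Z N"
    unfolding max_invariant_def by blast
  then show ?thesis
    unfolding eventually_sequentially using eq by metis
qed

definition out_boundary :: "nat \<Rightarrow> (nat \<times> nat) set \<Rightarrow> nat set \<Rightarrow> nat set" where
  "out_boundary n \<E> \<W> = {j \<in> {..<n} - \<W>. \<exists>i\<in>\<W>. (i, j) \<in> \<E>}"

end

theory Submission
  imports Defs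
begin

text \<open>
  Everything rests on the equation \<open>(A - B F) Z = Z X\<close>, which says that the span of \<open>\<Z>\<close> is invariant
  under the closed loop \<open>G = A - B F\<close>.  The columns of a basis matrix are orthonormal, the basis matrices
  of disjoint node sets are orthogonal, and \<open>Z Z\<^sup>T\<close> is the coordinate projection onto \<open>\<Z>\<close>.  Hence a
  matrix factors as \<open>Z X\<close> iff its rows outside \<open>\<Z>\<close> vanish (\<open>mat_supported_iff\<close>), and \<open>Y Z = 0\<close> iff
  \<open>Y = M Zp\<^sup>T\<close> for some \<open>M\<close>, where \<open>Zp\<close> belongs to the complement of \<open>\<Z>\<close> (\<open>mat_annihilates_iff\<close>).

  \<^emph>\<open>Friends.\<close>  Controlled invariance means that the columns of \<open>A Z\<close> are supported on \<open>\<Z> \<union> \<B>\<close>, so \<open>A Z\<close>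
  can be split as \<open>Z X + B U\<close>.  For \<open>F = U Z\<^sup>T + M Zp\<^sup>T\<close> orthonormality gives \<open>F Z = U\<close>, hence
  \<open>(A - B F) Z = A Z - B U = Z X\<close>, whatever \<open>M\<close> is.

  \<^emph>\<open>Decoupling.\<close>  Suppose that the image of \<open>D\<close> lies in the invariant subspace and that \<open>T\<close> vanishes on it.  The
  difference \<open>y\<close> of two trajectories with the same initial state satisfies, in the coordinates outside
  \<open>\<Z>\<close>, a closed homogeneous linear integral equation: neither the disturbances nor the coordinates in
  \<open>\<Z>\<close> enter.  A Gronwall estimate gives \<open>y = 0\<close> there (\<open>linear_integral_equation_zero\<close>), so \<open>y\<close> stays in
  the kernel of \<open>T\<close>.  In the frequency domain, an invertible \<open>P = s I - G\<close> maps the finite-dimensional subspace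
  injectively into itself, hence onto itself, so \<open>P\<^sup>-\<^sup>1\<close> preserves it too
  (\<open>inverse_preserves_invariant_subspace\<close>) and \<open>T P\<^sup>-\<^sup>1 D = 0\<close>.

  \<^emph>\<open>Uniqueness.\<close>  If \<open>\<B>\<close> is the out-boundary of \<open>\<Z>\<close>, then \<open>B\<^sup>T Z = 0\<close> and \<open>B\<^sup>T B = I\<close>.  Multiplying
  \<open>A Z - B F Z = Z X\<close> by \<open>B\<^sup>T\<close> therefore gives \<open>F Z = B\<^sup>T A Z\<close>, which determines \<open>F\<close> up to a matrix that annihilates
  \<open>Z\<close>, that is, up to \<open>M Zp\<^sup>T\<close>.  Conversely this equation suffices, because every edge leaving \<open>\<Z>\<close> ends
  in \<open>\<B>\<close> (\<open>friend_out_boundary_iff\<close>).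
\<close>

section \<open>Basis matrices of node sets\<close>

lemma basis_matrix_dims [simp]:
  "dim_row (basis_matrix n \<Z>) = n" "dim_col (basis_matrix n \<Z>) = card \<Z>"
  by (simp_all add: basis_matrix_def)

lemma basis_matrix_carrier [simp]:
  "basis_matrix n \<Z> \<in> carrier_mat n (card \<Z>)"
  by (rule carrier_matI) simp_all

lemma basis_matrix_index:
  assumes "\<Z> \<subseteq> {..<n}" "i < n" "k < card \<Z>"
  shows "basis_matrix n \<Z> $$ (i, k) = (if i = sorted_list_of_set \<Z> ! k then 1 else 0)"
proof -
  have "finite \<Z>" using assms(1) finite_subset by blast
  then have "sorted_list_of_set \<Z> ! k < n"
    using assms(1,3) nth_mem[of k "sorted_list_of_set \<Z>"] by auto
  then show ?thesis
    using assms(2,3) by (simp add: basis_matrix_def mat_of_cols_index)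
qed

text \<open>
  The columns of a basis matrix are numbered by \<open>0, \<dots>, card \<Z> - 1\<close>; this turns sums over column numbers
  into sums over nodes.
\<close>

lemma sum_over_nodes:
  fixes n :: nat
  assumes "\<Z> \<subseteq> {..<n}"
  shows "(\<Sum>k\<in>{0..<card \<Z>}. f (sorted_list_of_set \<Z> ! k)) = (\<Sum>i\<in>\<Z>. f i)"
proof -
  have "finite \<Z>" using assms finite_subset by blast
  then have "bij_betw ((!) (sorted_list_of_set \<Z>)) {0..<card \<Z>} \<Z>"
    by (intro bij_betw_nth) auto
  then show ?thesis by (rule sum.reindex_bij_betw[of _ _ _ f])
qed

lemma basis_matrix_projection:
  assumes "\<Z> \<subseteq> {..<n}"
  shows "basis_matrix n \<Z> * (basis_matrix n \<Z>)\<^sup>T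
    = mat n n (\<lambda>(i, j). if i = j \<and> i \<in> \<Z> then 1 else 0)"
proof (rule eq_matI)
  fix i j assume "i < dim_row (mat n n (\<lambda>(i, j). if i = j \<and> i \<in> \<Z> then 1 else 0 :: real))"
    "j < dim_col (mat n n (\<lambda>(i, j). if i = j \<and> i \<in> \<Z> then 1 else 0 :: real))"
  then have ij: "i < n" "j < n" by auto
  have fin: "finite \<Z>" using assms finite_subset by blast
  have "(basis_matrix n \<Z> * (basis_matrix n \<Z>)\<^sup>T) $$ (i, j)
    = (\<Sum>k\<in>{0..<card \<Z>}. (if i = sorted_list_of_set \<Z> ! k then 1 else 0) *
         (if j = sorted_list_of_set \<Z> ! k then 1 else 0))"
    using ij by (auto simp: scalar_prod_def basis_matrix_index[OF assms] intro!: sum.cong)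
  also have "\<dots> = (\<Sum>l\<in>\<Z>. (if i = l then 1 else 0) * (if j = l then 1 else 0))"
    by (rule sum_over_nodes[OF assms, where f = "\<lambda>l. (if i = l then 1 else 0) * (if j = l then 1 else 0)"])
  also have "\<dots> = (\<Sum>l\<in>\<Z>. if i = l then if i = j then 1 else 0 else 0)"
    by (rule sum.cong) auto
  also have "\<dots> = (if i = j \<and> i \<in> \<Z> then 1 else 0)"
    using fin by (simp add: sum.delta')
  finally show "(basis_matrix n \<Z> * (basis_matrix n \<Z>)\<^sup>T) $$ (i, j)
    = mat n n (\<lambda>(i, j). if i = j \<and> i \<in> \<Z> then 1 else 0) $$ (i, j)"
    using ij by simp
qed auto

lemma basis_matrix_projection_mult:
  assumes "\<Z> \<subseteq> {..<n}" "H \<in> carrier_mat n m" "i < n" "k < m"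
  shows "(basis_matrix n \<Z> * ((basis_matrix n \<Z>)\<^sup>T * H)) $$ (i, k) = (if i \<in> \<Z> then H $$ (i, k) else 0)"
proof -
  have "basis_matrix n \<Z> * ((basis_matrix n \<Z>)\<^sup>T * H)
      = mat n n (\<lambda>(i, j). if i = j \<and> i \<in> \<Z> then 1 else 0) * H"
    by (subst assoc_mult_mat[symmetric, where n\<^sub>2 = "card \<Z>"])
       (use assms in \<open>auto simp: basis_matrix_projection\<close>)
  also have "\<dots> $$ (i, k) = (\<Sum>j\<in>{0..<n}. (if i = j \<and> i \<in> \<Z> then 1 else 0) * H $$ (j, k))"
    using assms by (simp add: scalar_prod_def)
  also have "\<dots> = (\<Sum>j\<in>{0..<n}. if i = j then if i \<in> \<Z> then H $$ (j, k) else 0 else 0)"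
    by (rule sum.cong) auto
  also have "\<dots> = (if i \<in> \<Z> then H $$ (i, k) else 0)"
    using assms by (simp add: sum.delta')
  finally show ?thesis .
qed

lemma basis_matrix_orthonormal:
  assumes "\<Z> \<subseteq> {..<n}"
  shows "(basis_matrix n \<Z>)\<^sup>T * basis_matrix n \<Z> = 1\<^sub>m (card \<Z>)"
proof (rule eq_matI)
  fix k l assume "k < dim_row (1\<^sub>m (card \<Z>) :: real mat)" "l < dim_col (1\<^sub>m (card \<Z>) :: real mat)"
  then have kl: "k < card \<Z>" "l < card \<Z>" by auto
  have fin: "finite \<Z>" using assms finite_subset by blast
  let ?s = "sorted_list_of_set \<Z>"
  have mem: "?s ! k \<in> \<Z>"
    using fin kl nth_mem[of k ?s] by simp
  have "((basis_matrix n \<Z>)\<^sup>T * basis_matrix n \<Z>) $$ (k, l)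
    = (\<Sum>i\<in>{0..<n}. (if i = ?s ! k then 1 else 0) * (if i = ?s ! l then 1 else 0))"
    using kl by (simp add: scalar_prod_def basis_matrix_index[OF assms])
  also have "\<dots> = (\<Sum>i\<in>{0..<n}. if ?s ! k = i then if k = l then 1 else 0 else 0)"
    using kl fin nth_eq_iff_index_eq[of ?s k l] by (intro sum.cong) auto
  also have "\<dots> = (if k = l then 1 else 0)"
    using mem assms by (subst sum.delta') auto
  finally show "((basis_matrix n \<Z>)\<^sup>T * basis_matrix n \<Z>) $$ (k, l) = 1\<^sub>m (card \<Z>) $$ (k, l)"
    using kl by simp
qed auto

lemma basis_matrix_orthogonal:
  assumes "\<Z> \<subseteq> {..<n}" "\<W> \<subseteq> {..<n}" "\<Z> \<inter> \<W> = {}"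
  shows "(basis_matrix n \<Z>)\<^sup>T * basis_matrix n \<W> = 0\<^sub>m (card \<Z>) (card \<W>)"
proof (rule eq_matI)
  fix k l assume "k < dim_row (0\<^sub>m (card \<Z>) (card \<W>) :: real mat)"
    "l < dim_col (0\<^sub>m (card \<Z>) (card \<W>) :: real mat)"
  then have kl: "k < card \<Z>" "l < card \<W>" by auto
  have "finite \<Z>" "finite \<W>" using assms finite_subset by blast+
  then have "sorted_list_of_set \<Z> ! k \<in> \<Z>" "sorted_list_of_set \<W> ! l \<in> \<W>"
    using kl nth_mem[of k "sorted_list_of_set \<Z>"] nth_mem[of l "sorted_list_of_set \<W>"] by simp_all
  then have "sorted_list_of_set \<Z> ! k \<noteq> sorted_list_of_set \<W> ! l" using assms(3) by auto
  then have "(\<Sum>i\<in>{0..<n}. (if i = sorted_list_of_set \<Z> ! k then 1 else 0) *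
      (if i = sorted_list_of_set \<W> ! l then 1 else 0)) = (0 :: real)"
    by (intro sum.neutral) auto
  then have "((basis_matrix n \<Z>)\<^sup>T * basis_matrix n \<W>) $$ (k, l) = 0"
    using kl by (simp add: scalar_prod_def basis_matrix_index[OF assms(1)] basis_matrix_index[OF assms(2)])
  then show "((basis_matrix n \<Z>)\<^sup>T * basis_matrix n \<W>) $$ (k, l) = 0\<^sub>m (card \<Z>) (card \<W>) $$ (k, l)"
    using kl by simp
qed auto

text \<open>
  The projections onto \<open>\<Z>\<close> and onto its complement are diagonal, with complementary diagonals.
\<close>

lemma basis_matrix_complete:
  assumes "\<Z> \<subseteq> {..<n}"
  shows "basis_matrix n \<Z> * (basis_matrix n \<Z>)\<^sup>T
    + basis_matrix n ({..<n} - \<Z>) * (basis_matrix n ({..<n} - \<Z>))\<^sup>T = 1\<^sub>m n"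
  by (rule eq_matI) (auto simp: basis_matrix_projection[OF assms] basis_matrix_projection[of "{..<n} - \<Z>" n, OF Diff_subset])

text \<open>
  A matrix with rows supported on \<open>\<Z>\<close> is fixed by the projection \<open>Z Z\<^sup>T\<close>, so \<open>X = Z\<^sup>T H\<close> is a witness.
\<close>

lemma mat_supported_iff:
  assumes Z: "\<Z> \<subseteq> {..<n}" and H: "H \<in> carrier_mat n m"
  shows "(\<forall>i<n. i \<notin> \<Z> \<longrightarrow> (\<forall>k<m. H $$ (i, k) = 0)) \<longleftrightarrow>
    (\<exists>X\<in>carrier_mat (card \<Z>) m. H = basis_matrix n \<Z> * X)" (is "?L \<longleftrightarrow> ?R")
proof
  assume L: ?L
  have "H = basis_matrix n \<Z> * ((basis_matrix n \<Z>)\<^sup>T * H)"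
    by (rule eq_matI) (use L H basis_matrix_projection_mult[OF Z H] in auto)
  moreover have "(basis_matrix n \<Z>)\<^sup>T * H \<in> carrier_mat (card \<Z>) m" using H by auto
  ultimately show ?R by blast
next
  assume ?R
  then obtain X where X: "X \<in> carrier_mat (card \<Z>) m" "H = basis_matrix n \<Z> * X" by blast
  let ?Z = "basis_matrix n \<Z>"
  have "?Z\<^sup>T * H = X"
    unfolding X(2) by (subst assoc_mult_mat[symmetric, where n\<^sub>2 = n])
      (use X in \<open>auto simp: basis_matrix_orthonormal[OF Z]\<close>)
  then have "H = ?Z * (?Z\<^sup>T * H)" using X by simp
  then show ?L using basis_matrix_projection_mult[OF Z H] by metis
qed

text \<open>
  This describes the freedom in a feedback matrix that is prescribed on \<open>\<Z>\<close> only.  Writing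
  \<open>Y = Y (Z Z\<^sup>T + Zp Zp\<^sup>T)\<close> shows that \<open>M = Y Zp\<close> works.
\<close>

lemma mat_annihilates_iff:
  assumes Z: "\<Z> \<subseteq> {..<n}" and Y: "Y \<in> carrier_mat m n"
  shows "Y * basis_matrix n \<Z> = 0\<^sub>m m (card \<Z>) \<longleftrightarrow>
    (\<exists>M\<in>carrier_mat m (n - card \<Z>). Y = M * (basis_matrix n ({..<n} - \<Z>))\<^sup>T)" (is "?L \<longleftrightarrow> ?R")
proof -
  let ?Z = "basis_matrix n \<Z>" and ?Zp = "basis_matrix n ({..<n} - \<Z>)"
  have fin: "finite \<Z>" using Z finite_subset by blast
  have cd: "card ({..<n} - \<Z>) = n - card \<Z>"
    using Z fin by (simp add: card_Diff_subset)
  have Zp: "?Zp \<in> carrier_mat n (n - card \<Z>)" using basis_matrix_carrier[of n "{..<n} - \<Z>"] cd by simp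
  have Z': "?Z \<in> carrier_mat n (card \<Z>)" by simp
  show ?thesis
  proof
    assume L: ?L
    have "Y = Y * (?Z * ?Z\<^sup>T + ?Zp * ?Zp\<^sup>T)" using basis_matrix_complete[OF Z] Y by simp
    also have "\<dots> = Y * (?Z * ?Z\<^sup>T) + Y * (?Zp * ?Zp\<^sup>T)"
      using Y Z' Zp by (intro mult_add_distrib_mat[where nc = n]) auto
    also have "Y * (?Z * ?Z\<^sup>T) = Y * ?Z * ?Z\<^sup>T"
      using Y Z' by (intro assoc_mult_mat[symmetric]) auto
    also have "Y * (?Zp * ?Zp\<^sup>T) = Y * ?Zp * ?Zp\<^sup>T"
      using Y Zp by (intro assoc_mult_mat[symmetric]) auto
    also have "Y * ?Z * ?Z\<^sup>T + Y * ?Zp * ?Zp\<^sup>T = Y * ?Zp * ?Zp\<^sup>T"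
      unfolding L using Y Zp by (subst left_mult_zero_mat[where n = "card \<Z>" and nc = n]) auto
    finally show ?R using Y Zp by (intro bexI[of _ "Y * ?Zp"]) auto
  next
    assume ?R
    then obtain M where M: "M \<in> carrier_mat m (n - card \<Z>)" "Y = M * ?Zp\<^sup>T" by blast
    have "Y * ?Z = M * (?Zp\<^sup>T * ?Z)"
      unfolding M(2) using M(1) Z' Zp by (intro assoc_mult_mat) auto
    also have "?Zp\<^sup>T * ?Z = 0\<^sub>m (n - card \<Z>) (card \<Z>)"
      using basis_matrix_orthogonal[of "{..<n} - \<Z>" n \<Z>] Z cd by auto
    finally show ?L using M(1) by simp
  qed
qed

lemma mult_basis_matrix_index:
  assumes Z: "\<Z> \<subseteq> {..<n}" and G: "G \<in> carrier_mat m n" "i < m" "k < card \<Z>"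
  shows "(G * basis_matrix n \<Z>) $$ (i, k) = G $$ (i, sorted_list_of_set \<Z> ! k)"
proof -
  have "finite \<Z>" using Z finite_subset by blast
  then have mem: "sorted_list_of_set \<Z> ! k \<in> \<Z>"
    using G(3) nth_mem[of k "sorted_list_of_set \<Z>"] by simp
  have "(G * basis_matrix n \<Z>) $$ (i, k)
     = (\<Sum>j\<in>{0..<n}. G $$ (i, j) * (if j = sorted_list_of_set \<Z> ! k then 1 else 0))"
    using G by (simp add: scalar_prod_def basis_matrix_index[OF Z])
  also have "\<dots> = (\<Sum>j\<in>{0..<n}. if sorted_list_of_set \<Z> ! k = j then G $$ (i, j) else 0)"
    by (rule sum.cong) auto
  also have "\<dots> = G $$ (i, sorted_list_of_set \<Z> ! k)"
    using mem Z by (subst sum.delta') auto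
  finally show ?thesis .
qed

text \<open>
  The link between graph conditions and matrix equations: the entries from \<open>\<Z>\<close> to nodes outside \<open>\<W>\<close>
  vanish iff \<open>G\<close> maps the span of \<open>\<Z>\<close> into that of \<open>\<W>\<close>.  The columns of \<open>G Z\<close> are the columns of \<open>G\<close> at
  the nodes of \<open>\<Z>\<close>.
\<close>

lemma block_zero_iff:
  assumes Z: "\<Z> \<subseteq> {..<n}" and W: "\<W> \<subseteq> {..<n}" and G: "G \<in> carrier_mat n n"
  shows "(\<forall>j\<in>\<Z>. \<forall>i<n. i \<notin> \<W> \<longrightarrow> G $$ (i, j) = 0) \<longleftrightarrow>
    (\<exists>X\<in>carrier_mat (card \<W>) (card \<Z>). G * basis_matrix n \<Z> = basis_matrix n \<W> * X)"
proof -
  have fin: "finite \<Z>" using Z finite_subset by blast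
  have "(\<forall>j\<in>\<Z>. \<forall>i<n. i \<notin> \<W> \<longrightarrow> G $$ (i, j) = 0) \<longleftrightarrow>
    (\<forall>k<card \<Z>. \<forall>i<n. i \<notin> \<W> \<longrightarrow> G $$ (i, sorted_list_of_set \<Z> ! k) = 0)"
    using all_set_conv_all_nth[of "sorted_list_of_set \<Z>"
        "\<lambda>j. \<forall>i<n. i \<notin> \<W> \<longrightarrow> G $$ (i, j) = 0"] fin by simp
  also have "\<dots> \<longleftrightarrow> (\<forall>i<n. i \<notin> \<W> \<longrightarrow> (\<forall>k<card \<Z>. (G * basis_matrix n \<Z>) $$ (i, k) = 0))"
    using mult_basis_matrix_index[OF Z G] by auto
  also have "\<dots> \<longleftrightarrow> (\<exists>X\<in>carrier_mat (card \<W>) (card \<Z>). G * basis_matrix n \<Z> = basis_matrix n \<W> * X)"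
    by (rule mat_supported_iff[OF W]) (use G in auto)
  finally show ?thesis .
qed


section \<open>Coordinate subspaces\<close>

lemma basis_matrix_projection_vec:
  assumes "\<Z> \<subseteq> {..<n}" "v \<in> carrier_vec n" "i < n"
  shows "(basis_matrix n \<Z> *\<^sub>v ((basis_matrix n \<Z>)\<^sup>T *\<^sub>v v)) $ i = (if i \<in> \<Z> then v $ i else 0)"
proof -
  have "basis_matrix n \<Z> *\<^sub>v ((basis_matrix n \<Z>)\<^sup>T *\<^sub>v v)
      = mat n n (\<lambda>(i, j). if i = j \<and> i \<in> \<Z> then 1 else 0) *\<^sub>v v"
    by (subst assoc_mult_mat_vec[symmetric, where n\<^sub>2 = "card \<Z>"])
       (use assms in \<open>auto simp: basis_matrix_projection\<close>)
  also have "\<dots> $ i = (\<Sum>j\<in>{0..<n}. (if i = j \<and> i \<in> \<Z> then 1 else 0) * v $ j)"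
    using assms by (simp add: scalar_prod_def)
  also have "\<dots> = (\<Sum>j\<in>{0..<n}. if i = j then if i \<in> \<Z> then v $ j else 0 else 0)"
    by (rule sum.cong) auto
  also have "\<dots> = (if i \<in> \<Z> then v $ i else 0)"
    using assms by (simp add: sum.delta')
  finally show ?thesis .
qed

lemma node_space_eq_range:
  assumes "\<Z> \<subseteq> {..<n}"
  shows "node_space n \<Z> = {basis_matrix n \<Z> *\<^sub>v x |x. x \<in> carrier_vec (card \<Z>)}"
proof -
  interpret vec_space "TYPE(real)" n .
  have "finite \<Z>" using assms finite_subset by blast
  then have "set (cols (basis_matrix n \<Z>)) = unit_vec n ` \<Z>"
    unfolding basis_matrix_def by (subst cols_mat_of_cols) auto
  then have "node_space n \<Z> = col_space (basis_matrix n \<Z>)"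
    by (simp add: node_space_def col_space_def)
  also have "\<dots> = {basis_matrix n \<Z> *\<^sub>v x |x. x \<in> carrier_vec (card \<Z>)}"
    unfolding col_space_eq[OF basis_matrix_carrier]
    by (auto intro: mult_mat_vec_carrier[OF basis_matrix_carrier])
  finally show ?thesis .
qed

lemma mem_node_space_iff:
  assumes "\<Z> \<subseteq> {..<n}"
  shows "v \<in> node_space n \<Z> \<longleftrightarrow> v \<in> carrier_vec n \<and> (\<forall>i<n. i \<notin> \<Z> \<longrightarrow> v $ i = 0)"
proof
  let ?Z = "basis_matrix n \<Z>"
  assume "v \<in> node_space n \<Z>"
  then obtain x where x: "x \<in> carrier_vec (card \<Z>)" "v = ?Z *\<^sub>v x"
    by (auto simp: node_space_eq_range[OF assms])
  have v: "v \<in> carrier_vec n" unfolding x(2) by (rule mult_mat_vec_carrier[OF _ x(1)]) simp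
  have "?Z\<^sup>T *\<^sub>v v = (?Z\<^sup>T * ?Z) *\<^sub>v x"
    unfolding x(2) by (rule assoc_mult_mat_vec[symmetric, OF _ _ x(1)]) auto
  then have "?Z *\<^sub>v (?Z\<^sup>T *\<^sub>v v) = v"
    using x by (simp add: basis_matrix_orthonormal[OF assms])
  then show "v \<in> carrier_vec n \<and> (\<forall>i<n. i \<notin> \<Z> \<longrightarrow> v $ i = 0)"
    using v basis_matrix_projection_vec[OF assms v] by metis
next
  let ?Z = "basis_matrix n \<Z>"
  assume v: "v \<in> carrier_vec n \<and> (\<forall>i<n. i \<notin> \<Z> \<longrightarrow> v $ i = 0)"
  have "v = ?Z *\<^sub>v (?Z\<^sup>T *\<^sub>v v)"
    by (rule eq_vecI) (use v basis_matrix_projection_vec[OF assms] in auto)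
  moreover have "?Z\<^sup>T *\<^sub>v v \<in> carrier_vec (card \<Z>)"
    by (rule mult_mat_vec_carrier[of _ _ n]) (use v in auto)
  ultimately show "v \<in> node_space n \<Z>"
    unfolding node_space_eq_range[OF assms] by blast
qed

text \<open>
  Testing on the canonical vectors of \<open>\<Z>\<close> reads off the columns of \<open>G\<close>; linearity gives the converse.
\<close>

lemma image_node_space_subset_iff:
  assumes Z: "\<Z> \<subseteq> {..<n}" and W: "\<W> \<subseteq> {..<n}" and G: "G \<in> carrier_mat n n"
  shows "(\<lambda>v. G *\<^sub>v v) ` node_space n \<Z> \<subseteq> node_space n \<W> \<longleftrightarrow>
    (\<forall>j\<in>\<Z>. \<forall>i<n. i \<notin> \<W> \<longrightarrow> G $$ (i, j) = 0)"
proof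
  assume sub: "(\<lambda>v. G *\<^sub>v v) ` node_space n \<Z> \<subseteq> node_space n \<W>"
  show "\<forall>j\<in>\<Z>. \<forall>i<n. i \<notin> \<W> \<longrightarrow> G $$ (i, j) = 0"
  proof (intro ballI allI impI)
    fix i j assume j: "j \<in> \<Z>" and i: "i < n" "i \<notin> \<W>"
    have jn: "j < n" using j Z by auto
    have "unit_vec n j \<in> node_space n \<Z>"
      unfolding mem_node_space_iff[OF Z] using j jn by auto
    then have "G *\<^sub>v unit_vec n j \<in> node_space n \<W>" using sub by blast
    then have "(G *\<^sub>v unit_vec n j) $ i = 0"
      using i unfolding mem_node_space_iff[OF W] by blast
    then show "G $$ (i, j) = 0"
      using G i jn by (simp add: scalar_prod_right_unit)
  qed
next
  assume zero: "\<forall>j\<in>\<Z>. \<forall>i<n. i \<notin> \<W> \<longrightarrow> G $$ (i, j) = 0"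
  show "(\<lambda>v. G *\<^sub>v v) ` node_space n \<Z> \<subseteq> node_space n \<W>"
  proof (rule image_subsetI)
    fix v assume "v \<in> node_space n \<Z>"
    then have v: "v \<in> carrier_vec n" "\<And>i. i < n \<Longrightarrow> i \<notin> \<Z> \<Longrightarrow> v $ i = 0"
      unfolding mem_node_space_iff[OF Z] by blast+
    have "(G *\<^sub>v v) $ i = 0" if i: "i < n" "i \<notin> \<W>" for i
    proof -
      have "(G *\<^sub>v v) $ i = (\<Sum>j\<in>{0..<n}. G $$ (i, j) * v $ j)"
        using G v(1) i by (simp add: scalar_prod_def)
      also have "\<dots> = 0"
        by (rule sum.neutral) (use zero v(2) i in \<open>metis atLeastLessThan_iff mult_zero_left mult_zero_right\<close>)
      finally show ?thesis .
    qed
    moreover have "G *\<^sub>v v \<in> carrier_vec n" using G v(1) by simp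
    ultimately show "G *\<^sub>v v \<in> node_space n \<W>" unfolding mem_node_space_iff[OF W] by blast
  qed
qed

lemma node_space_sum:
  assumes Z: "\<Z> \<subseteq> {..<n}" and B: "\<B> \<subseteq> {..<n}"
  shows "{z + b |z b. z \<in> node_space n \<Z> \<and> b \<in> node_space n \<B>} = node_space n (\<Z> \<union> \<B>)"
proof -
  have ZB: "\<Z> \<union> \<B> \<subseteq> {..<n}" using assms by blast
  show ?thesis
  proof (intro equalityI subsetI)
    fix v assume "v \<in> {z + b |z b. z \<in> node_space n \<Z> \<and> b \<in> node_space n \<B>}"
    then show "v \<in> node_space n (\<Z> \<union> \<B>)"
      unfolding mem_node_space_iff[OF Z] mem_node_space_iff[OF B] mem_node_space_iff[OF ZB] by auto
  next
    fix v assume "v \<in> node_space n (\<Z> \<union> \<B>)"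
    then have v: "v \<in> carrier_vec n" "\<And>i. i < n \<Longrightarrow> i \<notin> \<Z> \<union> \<B> \<Longrightarrow> v $ i = 0"
      unfolding mem_node_space_iff[OF ZB] by blast+
    define z where "z = vec n (\<lambda>i. if i \<in> \<Z> then v $ i else 0)"
    define b where "b = vec n (\<lambda>i. if i \<in> \<Z> then 0 else v $ i)"
    have "z \<in> node_space n \<Z>" "b \<in> node_space n \<B>"
      unfolding mem_node_space_iff[OF Z] mem_node_space_iff[OF B] using v(2) by (auto simp: z_def b_def)
    moreover have "v = z + b"
      using v(1) by (intro eq_vecI) (auto simp: z_def b_def)
    ultimately show "v \<in> {z + b |z b. z \<in> node_space n \<Z> \<and> b \<in> node_space n \<B>}" by blast
  qed
qed

section \<open>Controlled invariance and friends\<close>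

lemma friend_iff:
  assumes Z: "\<Z> \<subseteq> {..<n}" and A: "A \<in> carrier_mat n n" and F: "F \<in> carrier_mat (card \<B>) n"
  shows "friend n A \<B> \<Z> F \<longleftrightarrow> (\<exists>X\<in>carrier_mat (card \<Z>) (card \<Z>).
    (A - basis_matrix n \<B> * F) * basis_matrix n \<Z> = basis_matrix n \<Z> * X)"
proof -
  have G: "A - basis_matrix n \<B> * F \<in> carrier_mat n n"
    using A F by (intro minus_carrier_mat mult_carrier_mat[of _ _ "card \<B>"]) auto
  show ?thesis
    using F unfolding friend_def image_node_space_subset_iff[OF Z Z G] block_zero_iff[OF Z Z G] by blast
qed

lemma closed_loop_mult:
  assumes A: "A \<in> carrier_mat n n" and F: "F \<in> carrier_mat (card \<B>) n"
  shows "(A - basis_matrix n \<B> * F) * basis_matrix n \<Z>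
    = A * basis_matrix n \<Z> - basis_matrix n \<B> * (F * basis_matrix n \<Z>)"
proof -
  have BF: "basis_matrix n \<B> * F \<in> carrier_mat n n"
    using F by (intro mult_carrier_mat[of _ _ "card \<B>"]) auto
  have "(A - basis_matrix n \<B> * F) * basis_matrix n \<Z>
    = A * basis_matrix n \<Z> - basis_matrix n \<B> * F * basis_matrix n \<Z>"
    by (rule minus_mult_distrib_mat[OF A BF basis_matrix_carrier])
  also have "basis_matrix n \<B> * F * basis_matrix n \<Z> = basis_matrix n \<B> * (F * basis_matrix n \<Z>)"
    by (rule assoc_mult_mat[OF _ F]) auto
  finally show ?thesis .
qed

text \<open>
  \<open>X = Z\<^sup>T A Z\<close> takes all rows of \<open>A Z\<close> in \<open>\<Z>\<close>, also those in \<open>\<Z> \<inter> \<B>\<close>.  The remainder \<open>A Z - Z X\<close> has its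
  rows in \<open>\<B>\<close>, since those of \<open>A Z\<close> lie in \<open>\<Z> \<union> \<B>\<close>, and so it factors through \<open>B\<close>.
\<close>

lemma controlled_invariant_factorization:
  assumes Z: "\<Z> \<subseteq> {..<n}" and B: "\<B> \<subseteq> {..<n}" and A: "A \<in> carrier_mat n n"
    and inv: "controlled_invariant n A \<B> \<Z>"
  shows "\<exists>U\<in>carrier_mat (card \<B>) (card \<Z>). \<exists>X\<in>carrier_mat (card \<Z>) (card \<Z>).
    A * basis_matrix n \<Z> = basis_matrix n \<Z> * X + basis_matrix n \<B> * U"
proof -
  let ?Z = "basis_matrix n \<Z>" and ?B = "basis_matrix n \<B>"
  define X where "X = ?Z\<^sup>T * (A * ?Z)"
  have AZ: "A * ?Z \<in> carrier_mat n (card \<Z>)" using A by simp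
  have X: "X \<in> carrier_mat (card \<Z>) (card \<Z>)"
    unfolding X_def using AZ by auto
  have ZX: "?Z * X \<in> carrier_mat n (card \<Z>)" using X by auto
  have ZB: "\<Z> \<union> \<B> \<subseteq> {..<n}" using Z B by blast
  have "\<forall>j\<in>\<Z>. \<forall>i<n. i \<notin> \<Z> \<union> \<B> \<longrightarrow> A $$ (i, j) = 0"
    using inv unfolding controlled_invariant_def node_space_sum[OF Z B]
      image_node_space_subset_iff[OF Z ZB A] .
  then obtain Y where Y: "Y \<in> carrier_mat (card (\<Z> \<union> \<B>)) (card \<Z>)" "A * ?Z = basis_matrix n (\<Z> \<union> \<B>) * Y"
    unfolding block_zero_iff[OF Z ZB A] by blast
  then have zero: "\<forall>i<n. i \<notin> \<Z> \<union> \<B> \<longrightarrow> (\<forall>k<card \<Z>. (A * ?Z) $$ (i, k) = 0)"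
    using mat_supported_iff[OF ZB AZ] by blast
  have "(A * ?Z - ?Z * X) $$ (i, k) = 0" if "i < n" "i \<notin> \<B>" "k < card \<Z>" for i k
  proof -
    have "(?Z * X) $$ (i, k) = (if i \<in> \<Z> then (A * ?Z) $$ (i, k) else 0)"
      unfolding X_def by (rule basis_matrix_projection_mult[OF Z AZ]) (use that in auto)
    moreover have "(A * ?Z - ?Z * X) $$ (i, k) = (A * ?Z) $$ (i, k) - (?Z * X) $$ (i, k)"
      by (rule index_minus_mat) (use ZX that in auto)
    ultimately show ?thesis using zero that by auto
  qed
  then have "\<exists>U\<in>carrier_mat (card \<B>) (card \<Z>). A * ?Z - ?Z * X = ?B * U"
    using mat_supported_iff[OF B, of "A * ?Z - ?Z * X" "card \<Z>"] ZX by (simp add: minus_carrier_mat)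
  then obtain U where U: "U \<in> carrier_mat (card \<B>) (card \<Z>)" "A * ?Z - ?Z * X = ?B * U" by blast
  have "A * ?Z = ?Z * X + (A * ?Z - ?Z * X)"
    by (rule eq_matI) (use AZ ZX in auto)
  then show ?thesis using U X by metis
qed

text \<open>
  By orthonormality \<open>F Z = U\<close>, so the closed loop \<open>A Z - B F Z\<close> loses exactly the part \<open>B U\<close> of \<open>A Z\<close>.
\<close>

lemma friend_of_factorization:
  assumes Z: "\<Z> \<subseteq> {..<n}" and A: "A \<in> carrier_mat n n"
    and U: "U \<in> carrier_mat (card \<B>) (card \<Z>)" and M: "M \<in> carrier_mat (card \<B>) (n - card \<Z>)"
    and X: "X \<in> carrier_mat (card \<Z>) (card \<Z>)"
    and eq: "A * basis_matrix n \<Z> = basis_matrix n \<Z> * X + basis_matrix n \<B> * U"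
  shows "friend n A \<B> \<Z> (U * (basis_matrix n \<Z>)\<^sup>T + M * (basis_matrix n ({..<n} - \<Z>))\<^sup>T)"
proof -
  let ?Z = "basis_matrix n \<Z>" and ?B = "basis_matrix n \<B>" and ?Zp = "basis_matrix n ({..<n} - \<Z>)"
  let ?Y = "M * ?Zp\<^sup>T" and ?F = "U * ?Z\<^sup>T + M * ?Zp\<^sup>T"
  have "finite \<Z>" using Z finite_subset by blast
  then have "card ({..<n} - \<Z>) = n - card \<Z>"
    using Z by (simp add: card_Diff_subset)
  then have Y: "?Y \<in> carrier_mat (card \<B>) n" using M by auto
  have UZ: "U * ?Z\<^sup>T \<in> carrier_mat (card \<B>) n" using U by auto
  have F: "?F \<in> carrier_mat (card \<B>) n" using UZ Y by simp
  have "?F * ?Z = U * ?Z\<^sup>T * ?Z + ?Y * ?Z"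
    by (rule add_mult_distrib_mat[OF UZ Y basis_matrix_carrier])
  also have "?Y * ?Z = 0\<^sub>m (card \<B>) (card \<Z>)"
    using mat_annihilates_iff[OF Z Y] M by blast
  also have "U * ?Z\<^sup>T * ?Z = U * (?Z\<^sup>T * ?Z)"
    by (rule assoc_mult_mat[OF U]) auto
  also have "\<dots> = U" using U by (simp add: basis_matrix_orthonormal[OF Z])
  finally have FZ: "?F * ?Z = U" using U by simp
  have "(A - ?B * ?F) * ?Z = ?Z * X + ?B * U - ?B * U"
    unfolding closed_loop_mult[OF A F] FZ eq ..
  also have "\<dots> = ?Z * X"
    by (rule eq_matI) (use X U in auto)
  finally show ?thesis unfolding friend_iff[OF Z A F] using X by blast
qed

text \<open>
  A friend of \<open>\<Z>\<close> has to cancel the rows of \<open>A Z\<close> in \<open>\<B>\<close>, because \<open>\<B>\<close> is disjoint from \<open>\<Z>\<close>: this forces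
  \<open>F Z = B\<^sup>T A Z\<close>.  Cancelling them is also enough, as no edge from \<open>\<Z>\<close> ends outside \<open>\<Z> \<union> \<B>\<close>.
\<close>

lemma friend_out_boundary_iff:
  assumes digraph: "weighted_digraph n \<E> A" and Z: "\<Z> \<subseteq> {..<n}"
    and B: "\<B> = out_boundary n \<E> \<Z>"
  shows "friend n A \<B> \<Z> F \<longleftrightarrow> (\<exists>M\<in>carrier_mat (card \<B>) (n - card \<Z>).
    F = (basis_matrix n \<B>)\<^sup>T * A + M * (basis_matrix n ({..<n} - \<Z>))\<^sup>T)"
proof -
  let ?Z = "basis_matrix n \<Z>" and ?B = "basis_matrix n \<B>" and ?Zp = "basis_matrix n ({..<n} - \<Z>)"
  have A: "A \<in> carrier_mat n n" using digraph by (simp add: weighted_digraph_def)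
  have Bn: "\<B> \<subseteq> {..<n}" and BZ: "\<B> \<inter> \<Z> = {}" using B by (auto simp: out_boundary_def)
  have "finite \<Z>" using Z finite_subset by blast
  then have cd: "card ({..<n} - \<Z>) = n - card \<Z>"
    using Z by (simp add: card_Diff_subset)
  have BA: "?B\<^sup>T * A \<in> carrier_mat (card \<B>) n" using A by auto
  have AZ: "A * ?Z \<in> carrier_mat n (card \<Z>)" using A by simp
  have BAZ: "?B\<^sup>T * A * ?Z = ?B\<^sup>T * (A * ?Z)"
    by (rule assoc_mult_mat[OF _ A]) auto
  have inv: "controlled_invariant n A \<B> \<Z>"
  proof -
    have ZB: "\<Z> \<union> \<B> \<subseteq> {..<n}" using Z Bn by blast
    have "\<forall>j\<in>\<Z>. \<forall>i<n. i \<notin> \<Z> \<union> \<B> \<longrightarrow> A $$ (i, j) = 0"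
      using digraph Z unfolding weighted_digraph_def B out_boundary_def by blast
    then show ?thesis
      unfolding controlled_invariant_def node_space_sum[OF Z Bn] image_node_space_subset_iff[OF Z ZB A] .
  qed
  obtain U X where U: "U \<in> carrier_mat (card \<B>) (card \<Z>)" and X: "X \<in> carrier_mat (card \<Z>) (card \<Z>)"
    and eq: "A * ?Z = ?Z * X + ?B * U"
    using controlled_invariant_factorization[OF Z Bn A inv] by blast
  \<comment> \<open>The coefficient of \<open>B\<close> in such a decomposition is unique; this applies to \<open>U\<close> and to \<open>F Z\<close>.\<close>
  have left: "?B\<^sup>T * (?Z * V + ?B * W) = W"
    if V: "V \<in> carrier_mat (card \<Z>) (card \<Z>)" and W: "W \<in> carrier_mat (card \<B>) (card \<Z>)" for V W
  proof -
    have "?B\<^sup>T * (?Z * V + ?B * W) = ?B\<^sup>T * (?Z * V) + ?B\<^sup>T * (?B * W)"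
      by (rule mult_add_distrib_mat[of _ _ n]) (use V W in auto)
    also have "?B\<^sup>T * (?Z * V) = ?B\<^sup>T * ?Z * V"
      by (rule assoc_mult_mat[symmetric, OF _ _ V]) auto
    also have "?B\<^sup>T * (?B * W) = ?B\<^sup>T * ?B * W"
      by (rule assoc_mult_mat[symmetric, OF _ _ W]) auto
    finally show ?thesis
      using V W by (simp add: basis_matrix_orthonormal[OF Bn] basis_matrix_orthogonal[OF Bn Z BZ])
  qed
  have friend_iff_agrees: "friend n A \<B> \<Z> F \<longleftrightarrow> F * ?Z = ?B\<^sup>T * A * ?Z" if F: "F \<in> carrier_mat (card \<B>) n"
  proof
    have FZ: "F * ?Z \<in> carrier_mat (card \<B>) (card \<Z>)" using F by simp
    assume "friend n A \<B> \<Z> F"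
    then obtain V where V: "V \<in> carrier_mat (card \<Z>) (card \<Z>)" "A * ?Z - ?B * (F * ?Z) = ?Z * V"
      unfolding friend_iff[OF Z A F] closed_loop_mult[OF A F] by blast
    have "A * ?Z = (A * ?Z - ?B * (F * ?Z)) + ?B * (F * ?Z)"
      by (rule eq_matI) (use AZ FZ in auto)
    then have "A * ?Z = ?Z * V + ?B * (F * ?Z)" unfolding V(2) .
    then show "F * ?Z = ?B\<^sup>T * A * ?Z"
      unfolding BAZ using left[OF V(1) FZ] by simp
  next
    assume "F * ?Z = ?B\<^sup>T * A * ?Z"
    then have "F * ?Z = U" unfolding BAZ eq left[OF X U] .
    then have "(A - ?B * F) * ?Z = ?Z * X + ?B * U - ?B * U"
      unfolding closed_loop_mult[OF A F] eq by simp
    also have "\<dots> = ?Z * X"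
      by (rule eq_matI) (use X U in auto)
    finally show "friend n A \<B> \<Z> F" unfolding friend_iff[OF Z A F] using X by blast
  qed
  show ?thesis
  proof
    assume fr: "friend n A \<B> \<Z> F"
    then have F: "F \<in> carrier_mat (card \<B>) n" by (simp add: friend_def)
    have FZ: "F * ?Z \<in> carrier_mat (card \<B>) (card \<Z>)" using F by simp
    have "(F - ?B\<^sup>T * A) * ?Z = F * ?Z - ?B\<^sup>T * A * ?Z"
      by (rule minus_mult_distrib_mat[OF F BA basis_matrix_carrier])
    also have "\<dots> = 0\<^sub>m (card \<B>) (card \<Z>)"
      using friend_iff_agrees[OF F] fr FZ by auto
    finally obtain M where M: "M \<in> carrier_mat (card \<B>) (n - card \<Z>)" "F - ?B\<^sup>T * A = M * ?Zp\<^sup>T"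
      using mat_annihilates_iff[OF Z, of "F - ?B\<^sup>T * A"] BA by (auto simp: minus_carrier_mat)
    have "F = ?B\<^sup>T * A + (F - ?B\<^sup>T * A)"
      by (rule eq_matI) (use F BA in auto)
    then show "\<exists>M\<in>carrier_mat (card \<B>) (n - card \<Z>). F = ?B\<^sup>T * A + M * ?Zp\<^sup>T"
      using M by metis
  next
    assume "\<exists>M\<in>carrier_mat (card \<B>) (n - card \<Z>). F = ?B\<^sup>T * A + M * ?Zp\<^sup>T"
    then obtain M where M: "M \<in> carrier_mat (card \<B>) (n - card \<Z>)" "F = ?B\<^sup>T * A + M * ?Zp\<^sup>T" by blast
    have Y: "M * ?Zp\<^sup>T \<in> carrier_mat (card \<B>) n" using M(1) cd by auto
    have F: "F \<in> carrier_mat (card \<B>) n" using M(2) BA Y by simp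
    have "F * ?Z = ?B\<^sup>T * A * ?Z + M * ?Zp\<^sup>T * ?Z"
      unfolding M(2) by (rule add_mult_distrib_mat[OF BA Y basis_matrix_carrier])
    also have "M * ?Zp\<^sup>T * ?Z = 0\<^sub>m (card \<B>) (card \<Z>)"
      using mat_annihilates_iff[OF Z Y] M(1) by blast
    finally show "friend n A \<B> \<Z> F"
      unfolding friend_iff_agrees[OF F] using BA by simp
  qed
qed

section \<open>Uniqueness for linear integral equations\<close>

text \<open>
  An energy estimate.  The right-hand sides are continuous, being integrals combined linearly, so \<open>y\<close> is
  differentiable, and \<open>\<phi> = \<Sum>i. (y i)\<^sup>2\<close> satisfies \<open>\<phi>' \<le> K \<phi>\<close>.  Then \<open>exp (- K t) \<phi> t\<close> is nonincreasing and
  starts at \<open>0\<close>.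
\<close>

lemma linear_integral_equation_zero:
  fixes y :: "'i \<Rightarrow> real \<Rightarrow> real" and G :: "'i \<Rightarrow> 'i \<Rightarrow> real"
  assumes fin: "finite I"
    and eq: "\<And>i t. i \<in> I \<Longrightarrow> 0 \<le> t \<Longrightarrow> ((\<lambda>s. \<Sum>j\<in>I. G i j * y j s) has_integral y i t) {0..t}"
    and i: "i \<in> I" and t: "0 \<le> t"
  shows "y i t = 0"
proof -
  let ?f = "\<lambda>i s. \<Sum>j\<in>I. G i j * y j s"
  have y_eq: "y i s = integral {0..s} (?f i)" if "i \<in> I" "0 \<le> s" for i s
    using eq[OF that] by (simp add: integral_unique)
  have cont_y: "continuous_on {0..t} (y i)" if "i \<in> I" for i
  proof -
    have "continuous_on {0..t} (\<lambda>s. integral {0..s} (?f i))"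
      by (rule indefinite_integral_continuous_1) (use eq[OF that t] in blast)
    then show ?thesis
      by (rule continuous_on_cong[THEN iffD1, rotated -1]) (use y_eq that in auto)
  qed
  have cont_f: "continuous_on {0..t} (?f i)" for i
    by (intro continuous_intros cont_y)
  have deriv_y: "(y i has_real_derivative ?f i s) (at s)" if "i \<in> I" "0 < s" "s < t" for i s
  proof -
    have "((\<lambda>u. integral {0..u} (?f i)) has_real_derivative ?f i s) (at s within {0..t})"
      by (rule integral_has_real_derivative[OF cont_f]) (use that in auto)
    then have "(y i has_real_derivative ?f i s) (at s within {0..t})"
      by (rule has_field_derivative_transform_within[where d = 1]) (use y_eq that in auto)
    then show ?thesis using that by (simp add: at_within_Icc_at)
  qed
  define \<phi> where "\<phi> s = (\<Sum>i\<in>I. (y i s)\<^sup>2)" for s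
  define K where "K = (\<Sum>i\<in>I. \<Sum>j\<in>I. 2 * \<bar>G i j\<bar>)"
  \<comment> \<open>The geometric mean of two summands of \<open>\<phi>\<close> is at most \<open>\<phi>\<close>; this is where \<open>K\<close> comes from.\<close>
  have le: "\<bar>y i s * y j s\<bar> \<le> \<phi> s" if "i \<in> I" "j \<in> I" for i j s
  proof -
    have "(y i s)\<^sup>2 \<le> \<phi> s" "(y j s)\<^sup>2 \<le> \<phi> s"
      unfolding \<phi>_def using that fin by (auto intro!: member_le_sum)
    moreover have "2 * \<bar>y i s * y j s\<bar> \<le> (y i s)\<^sup>2 + (y j s)\<^sup>2"
      using sum_squares_bound[of "\<bar>y i s\<bar>" "\<bar>y j s\<bar>"] by (simp add: abs_mult)
    ultimately show ?thesis by linarith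
  qed
  have growth: "(\<Sum>i\<in>I. 2 * y i s * ?f i s) \<le> K * \<phi> s" for s
  proof -
    have "(\<Sum>i\<in>I. 2 * y i s * ?f i s) = (\<Sum>i\<in>I. \<Sum>j\<in>I. 2 * G i j * (y i s * y j s))"
      by (simp add: sum_distrib_left algebra_simps)
    also have "\<dots> \<le> (\<Sum>i\<in>I. \<Sum>j\<in>I. 2 * \<bar>G i j\<bar> * \<phi> s)"
    proof (intro sum_mono)
      fix i j assume "i \<in> I" "j \<in> I"
      have "2 * G i j * (y i s * y j s) \<le> \<bar>2 * G i j * (y i s * y j s)\<bar>" by simp
      also have "\<dots> = 2 * \<bar>G i j\<bar> * \<bar>y i s * y j s\<bar>" by (simp add: abs_mult)
      also have "\<dots> \<le> 2 * \<bar>G i j\<bar> * \<phi> s"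
        by (rule mult_left_mono[OF le]) (use \<open>i \<in> I\<close> \<open>j \<in> I\<close> in auto)
      finally show "2 * G i j * (y i s * y j s) \<le> 2 * \<bar>G i j\<bar> * \<phi> s" .
    qed
    also have "\<dots> = K * \<phi> s" by (simp add: K_def sum_distrib_right)
    finally show ?thesis .
  qed
  have "exp (- K * t) * \<phi> t \<le> exp (- K * 0) * \<phi> 0"
  proof (rule DERIV_nonpos_imp_decreasing_open[OF t])
    fix s assume s: "0 < s" "s < t"
    let ?d = "\<Sum>i\<in>I. 2 * y i s * ?f i s"
    have "(\<phi> has_real_derivative ?d) (at s)"
      unfolding \<phi>_def
      by (rule DERIV_sum) (auto intro!: derivative_eq_intros deriv_y s)
    then have "((\<lambda>s. exp (- K * s) * \<phi> s) has_real_derivative exp (- K * s) * (?d - K * \<phi> s)) (at s)"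
      by (auto intro!: derivative_eq_intros simp: algebra_simps)
    moreover have "exp (- K * s) * (?d - K * \<phi> s) \<le> 0"
      using growth[of s] by (simp add: mult_le_0_iff)
    ultimately show "\<exists>d. ((\<lambda>s. exp (- K * s) * \<phi> s) has_real_derivative d) (at s) \<and> d \<le> 0" by blast
  next
    show "continuous_on {0..t} (\<lambda>s. exp (- K * s) * \<phi> s)"
      unfolding \<phi>_def by (intro continuous_intros cont_y)
  qed
  moreover have "\<phi> 0 = 0"
    unfolding \<phi>_def using y_eq[of _ 0] by (intro sum.neutral) auto
  ultimately have "\<phi> t \<le> 0" by (simp add: mult_le_0_iff)
  moreover have "(y i t)\<^sup>2 \<le> \<phi> t"
    unfolding \<phi>_def using i fin by (auto intro!: member_le_sum)
  ultimately show ?thesis by (smt (verit) zero_le_power2 power2_eq_iff zero_power2)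
qed

section \<open>Disturbance decoupling\<close>

text \<open>
  Outside an invariant \<open>\<Z>\<close> containing the image of \<open>D\<close>, the closed-loop dynamics involves neither the
  disturbance nor the coordinates in \<open>\<Z>\<close>.
\<close>

lemma closed_loop_index:
  fixes A B F D :: "'a :: comm_ring mat"
  assumes Z: "\<Z> \<subseteq> {..<n}" and A: "A \<in> carrier_mat n n" and B: "B \<in> carrier_mat n m" and F: "F \<in> carrier_mat m n"
    and D: "D \<in> carrier_mat n d"
    and blk: "\<forall>j\<in>\<Z>. \<forall>i<n. i \<notin> \<Z> \<longrightarrow> (A - B * F) $$ (i, j) = 0"
    and D0: "\<forall>i<n. i \<notin> \<Z> \<longrightarrow> (\<forall>k<d. D $$ (i, k) = 0)"
    and x: "x \<in> carrier_vec n" and w: "w \<in> carrier_vec d" and i: "i < n" "i \<notin> \<Z>"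
  shows "(A *\<^sub>v x + B *\<^sub>v (- (F *\<^sub>v x)) + D *\<^sub>v w) $ i = (\<Sum>j\<in>{..<n} - \<Z>. (A - B * F) $$ (i, j) * x $ j)"
proof -
  have Fx: "F *\<^sub>v x \<in> carrier_vec m" using F x by simp
  have BF: "B * F \<in> carrier_mat n n" using B F by simp
  have "(D *\<^sub>v w) $ i = (\<Sum>k\<in>{0..<d}. D $$ (i, k) * w $ k)"
    using D w i by (simp add: scalar_prod_def)
  also have "\<dots> = 0" by (rule sum.neutral) (use D0 i in auto)
  finally have Dw: "(D *\<^sub>v w) $ i = 0" .
  have "B *\<^sub>v (- (F *\<^sub>v x)) = - (B *\<^sub>v (F *\<^sub>v x))"
    by (rule eq_vecI) (use B F in auto)
  then have "A *\<^sub>v x + B *\<^sub>v (- (F *\<^sub>v x)) = (A - B * F) *\<^sub>v x"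
    unfolding minus_mult_distrib_mat_vec[OF A BF x] assoc_mult_mat_vec[OF B F x]
    using A B Fx x by (intro eq_vecI) auto
  then have "(A *\<^sub>v x + B *\<^sub>v (- (F *\<^sub>v x)) + D *\<^sub>v w) $ i = ((A - B * F) *\<^sub>v x) $ i"
    using i D Dw by simp
  also have "\<dots> = (\<Sum>j\<in>{0..<n}. (A - B * F) $$ (i, j) * x $ j)"
    using minus_carrier_mat[OF BF, of A] x i(1) by (simp add: scalar_prod_def del: index_minus_mat)
  also have "\<dots> = (\<Sum>j\<in>{..<n} - \<Z>. (A - B * F) $$ (i, j) * x $ j)"
    by (rule sum.mono_neutral_right) (use blk i in auto)
  finally show ?thesis .
qed

text \<open>
  Coordinates outside \<open>\<Z>\<close> of the difference of two trajectories obey a homogeneous linear integral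
  equation, hence vanish.  So the difference stays in the span of \<open>\<Z>\<close>, on which \<open>T\<close> vanishes.
\<close>

lemma invariant_subspace_solves_DDPSF:
  assumes Z: "\<Z> \<subseteq> {..<n}" and A: "A \<in> carrier_mat n n" and B: "B \<in> carrier_mat n m" and F: "F \<in> carrier_mat m n"
    and D: "D \<in> carrier_mat n d" and T: "T \<in> carrier_mat l n"
    and X: "X \<in> carrier_mat (card \<Z>) (card \<Z>)" "(A - B * F) * basis_matrix n \<Z> = basis_matrix n \<Z> * X"
    and Y: "Y \<in> carrier_mat (card \<Z>) d" "D = basis_matrix n \<Z> * Y"
    and TZ: "T * basis_matrix n \<Z> = 0\<^sub>m l (card \<Z>)"
  shows "solves_DDPSF A B D T F"
  unfolding solves_DDPSF_def
proof (intro allI impI)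
  fix w\<^sub>1 w\<^sub>2 x\<^sub>1 x\<^sub>2 :: "real \<Rightarrow> real vec" and t :: real
  assume w: "\<forall>t\<ge>0. w\<^sub>1 t \<in> carrier_vec (dim_col D) \<and> w\<^sub>2 t \<in> carrier_vec (dim_col D)"
    and tr: "trajectory A B D x\<^sub>1 (\<lambda>t. - (F *\<^sub>v x\<^sub>1 t)) w\<^sub>1" "trajectory A B D x\<^sub>2 (\<lambda>t. - (F *\<^sub>v x\<^sub>2 t)) w\<^sub>2"
    and init: "x\<^sub>1 0 = x\<^sub>2 0" and t: "0 \<le> t"
  have G: "A - B * F \<in> carrier_mat n n" using B F by (simp add: minus_carrier_mat)
  have blk: "\<forall>j\<in>\<Z>. \<forall>i<n. i \<notin> \<Z> \<longrightarrow> (A - B * F) $$ (i, j) = 0"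
    using X block_zero_iff[OF Z Z G] by blast
  have D0: "\<forall>i<n. i \<notin> \<Z> \<longrightarrow> (\<forall>k<d. D $$ (i, k) = 0)"
    using Y mat_supported_iff[OF Z D] by blast
  have x: "x\<^sub>1 s \<in> carrier_vec n" "x\<^sub>2 s \<in> carrier_vec n" if "0 \<le> s" for s
    using tr that A unfolding trajectory_def by auto
  let ?y = "\<lambda>i s. x\<^sub>1 s $ i - x\<^sub>2 s $ i"
  let ?rhs = "\<lambda>x w s. A *\<^sub>v x s + B *\<^sub>v (- (F *\<^sub>v x s)) + D *\<^sub>v w s"
  have y0: "?y i t = 0" if i: "i \<in> {..<n} - \<Z>" for i
  proof (rule linear_integral_equation_zero[where I = "{..<n} - \<Z>" and G = "\<lambda>i j. (A - B * F) $$ (i, j)" and y = ?y])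
    fix i s assume i: "i \<in> {..<n} - \<Z>" and s: "(0 :: real) \<le> s"
    have int: "((\<lambda>s. ?rhs x\<^sub>1 w\<^sub>1 s $ i) has_integral (x\<^sub>1 s $ i - x\<^sub>1 0 $ i)) {0..s}"
      "((\<lambda>s. ?rhs x\<^sub>2 w\<^sub>2 s $ i) has_integral (x\<^sub>2 s $ i - x\<^sub>2 0 $ i)) {0..s}"
      using tr s i A unfolding trajectory_def by auto
    have "((\<lambda>s. ?rhs x\<^sub>1 w\<^sub>1 s $ i - ?rhs x\<^sub>2 w\<^sub>2 s $ i) has_integral ?y i s) {0..s}"
      using has_integral_diff[OF int] init by simp
    moreover have "?rhs x\<^sub>1 w\<^sub>1 r $ i - ?rhs x\<^sub>2 w\<^sub>2 r $ i = (\<Sum>j\<in>{..<n} - \<Z>. (A - B * F) $$ (i, j) * ?y j r)"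
      if "r \<in> {0..s}" for r
    proof -
      have r: "0 \<le> r" using that by simp
      have w': "w\<^sub>1 r \<in> carrier_vec d" "w\<^sub>2 r \<in> carrier_vec d" using w r D by auto
      have i': "i < n" "i \<notin> \<Z>" using i by auto
      show ?thesis
        unfolding closed_loop_index[OF Z A B F D blk D0 x(1)[OF r] w'(1) i']
          closed_loop_index[OF Z A B F D blk D0 x(2)[OF r] w'(2) i']
        by (simp add: sum_subtractf right_diff_distrib)
    qed
    ultimately show "((\<lambda>s. \<Sum>j\<in>{..<n} - \<Z>. (A - B * F) $$ (i, j) * ?y j s) has_integral ?y i s) {0..s}"
      by (rule has_integral_eq[rotated])
  qed (use i t in auto)
  have "x\<^sub>1 t - x\<^sub>2 t \<in> node_space n \<Z>"
    unfolding mem_node_space_iff[OF Z] using y0 x[OF t] by auto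
  then obtain v where v: "v \<in> carrier_vec (card \<Z>)" "x\<^sub>1 t - x\<^sub>2 t = basis_matrix n \<Z> *\<^sub>v v"
    unfolding node_space_eq_range[OF Z] by blast
  have "T *\<^sub>v x\<^sub>1 t - T *\<^sub>v x\<^sub>2 t = T *\<^sub>v (basis_matrix n \<Z> *\<^sub>v v)"
    unfolding v(2)[symmetric] by (rule mult_minus_distrib_mat_vec[symmetric, OF T x[OF t]])
  also have "\<dots> = (T * basis_matrix n \<Z>) *\<^sub>v v"
    by (rule assoc_mult_mat_vec[symmetric, OF T _ v(1)]) simp
  also have "\<dots> = 0\<^sub>v l" unfolding TZ using v(1) by (intro eq_vecI) auto
  finally have diff: "T *\<^sub>v x\<^sub>1 t - T *\<^sub>v x\<^sub>2 t = 0\<^sub>v l" .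
  show "T *\<^sub>v x\<^sub>1 t = T *\<^sub>v x\<^sub>2 t"
  proof (rule eq_vecI)
    fix i assume "i < dim_vec (T *\<^sub>v x\<^sub>2 t)"
    then have "i < l" using T by simp
    then have "(T *\<^sub>v x\<^sub>1 t - T *\<^sub>v x\<^sub>2 t) $ i = 0" unfolding diff by simp
    then show "(T *\<^sub>v x\<^sub>1 t) $ i = (T *\<^sub>v x\<^sub>2 t) $ i" using \<open>i < l\<close> T by (simp del: index_mult_mat_vec)
  qed simp
qed

text \<open>
  Here \<open>Q\<close> is the matrix of \<open>P\<close> restricted to the column space of \<open>Z\<close>.  From \<open>P Z = Z Q\<close> follows
  \<open>L R Z Q = L R P Z = I\<close>, so \<open>Q\<close>, being square, is invertible with inverse \<open>W = L R Z\<close>; then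
  \<open>R Z = R Z Q W = R P Z W = Z W\<close>.
\<close>

lemma inverse_preserves_invariant_subspace:
  fixes P :: "'a :: field mat"
  assumes P: "P \<in> carrier_mat n n" and R: "R \<in> carrier_mat n n" and RP: "R * P = 1\<^sub>m n"
    and Z: "Z \<in> carrier_mat n k" and L: "L \<in> carrier_mat k n" and LZ: "L * Z = 1\<^sub>m k"
    and Q: "Q \<in> carrier_mat k k" and PZ: "P * Z = Z * Q"
  shows "R * Z = Z * (L * (R * Z))"
proof -
  have RZ: "R * Z \<in> carrier_mat n k" using R Z by simp
  have W: "L * (R * Z) \<in> carrier_mat k k" using L RZ by simp
  have RZQ: "R * Z * Q = Z"
  proof -
    have "R * Z * Q = R * (P * Z)" unfolding PZ by (rule assoc_mult_mat[OF R Z Q])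
    also have "\<dots> = R * P * Z" by (rule assoc_mult_mat[symmetric, OF R P Z])
    finally show ?thesis using Z by (simp add: RP)
  qed
  have "L * (R * Z) * Q = L * (R * Z * Q)" by (rule assoc_mult_mat[OF L RZ Q])
  then have "L * (R * Z) * Q = 1\<^sub>m k" by (simp add: RZQ LZ)
  then have right: "Q * (L * (R * Z)) = 1\<^sub>m k" by (rule mat_mult_left_right_inverse[OF W Q])
  have "R * Z = R * Z * (Q * (L * (R * Z)))" unfolding right by (rule right_mult_one_mat[OF RZ, symmetric])
  also have "\<dots> = R * Z * Q * (L * (R * Z))" by (rule assoc_mult_mat[symmetric, OF RZ Q W])
  finally show ?thesis by (simp add: RZQ)
qed

text \<open>
  With \<open>R Z = Z W\<close> and \<open>D = Z Y\<close> the transfer matrix is \<open>T R D = T Z W Y = 0\<close>.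
\<close>

lemma invariant_subspace_solves_DDPSF_freq:
  assumes Z: "\<Z> \<subseteq> {..<n}" and A: "A \<in> carrier_mat n n" and B: "B \<in> carrier_mat n m" and F: "F \<in> carrier_mat m n"
    and D: "D \<in> carrier_mat n d" and T: "T \<in> carrier_mat l n"
    and X: "X \<in> carrier_mat (card \<Z>) (card \<Z>)" "(A - B * F) * basis_matrix n \<Z> = basis_matrix n \<Z> * X"
    and Y: "Y \<in> carrier_mat (card \<Z>) d" "D = basis_matrix n \<Z> * Y"
    and TZ: "T * basis_matrix n \<Z> = 0\<^sub>m l (card \<Z>)"
  shows "solves_DDPSF_freq A B D T F"
  unfolding solves_DDPSF_freq_def Let_def
proof (intro allI ballI impI)
  fix s :: complex and R :: "complex mat"
  let ?c = "map_mat complex_of_real" and ?k = "card \<Z>"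
  let ?P = "s \<cdot>\<^sub>m 1\<^sub>m (dim_row A) - ?c A + ?c (B * F)"
  let ?Z = "?c (basis_matrix n \<Z>)"
  assume R': "R \<in> carrier_mat (dim_row A) (dim_row A)"
    and inv: "inverts_mat ?P R \<and> inverts_mat R ?P"
  have R: "R \<in> carrier_mat n n" using R' A by simp
  have G: "A - B * F \<in> carrier_mat n n" using B F by (simp add: minus_carrier_mat)
  have P_eq: "?P = s \<cdot>\<^sub>m 1\<^sub>m n - ?c (A - B * F)"
    by (rule eq_matI) (use A B F in \<open>auto simp del: index_mult_mat(1)\<close>)
  have P: "?P \<in> carrier_mat n n" unfolding P_eq using G by (simp add: minus_carrier_mat)
  have RP: "R * ?P = 1\<^sub>m n" using inv R unfolding inverts_mat_def by simp
  have Zc: "?Z \<in> carrier_mat n ?k" by simp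
  have L: "?c ((basis_matrix n \<Z>)\<^sup>T) \<in> carrier_mat ?k n" by simp
  have LZ: "?c ((basis_matrix n \<Z>)\<^sup>T) * ?Z = 1\<^sub>m ?k"
    by (subst of_real_hom.mat_hom_mult[symmetric, where n = n])
      (auto simp: basis_matrix_orthonormal[OF Z] of_real_hom.mat_hom_one)
  let ?Q = "s \<cdot>\<^sub>m 1\<^sub>m ?k - ?c X"
  have Q: "?Q \<in> carrier_mat ?k ?k" using X(1) by (simp add: minus_carrier_mat)
  have "?P * ?Z = s \<cdot>\<^sub>m 1\<^sub>m n * ?Z - ?c (A - B * F) * ?Z"
    unfolding P_eq by (rule minus_mult_distrib_mat[of _ n n]) (use G in auto)
  also have "?c (A - B * F) * ?Z = ?c ((A - B * F) * basis_matrix n \<Z>)"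
    by (rule of_real_hom.mat_hom_mult[symmetric, OF G basis_matrix_carrier])
  also have "\<dots> = ?Z * ?c X"
    unfolding X(2) by (rule of_real_hom.mat_hom_mult[OF basis_matrix_carrier X(1)])
  also have "s \<cdot>\<^sub>m 1\<^sub>m n * ?Z = ?Z * (s \<cdot>\<^sub>m 1\<^sub>m ?k)"
    by (simp add: mult_smult_assoc_mat[OF one_carrier_mat Zc] mult_smult_distrib[OF Zc one_carrier_mat])
  also have "?Z * (s \<cdot>\<^sub>m 1\<^sub>m ?k) - ?Z * ?c X = ?Z * ?Q"
    by (rule mult_minus_distrib_mat[symmetric, of _ n ?k]) (use X(1) in auto)
  finally have PZ: "?P * ?Z = ?Z * ?Q" .
  obtain W where W: "W \<in> carrier_mat ?k ?k" "R * ?Z = ?Z * W"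
    using inverse_preserves_invariant_subspace[OF P R RP Zc L LZ Q PZ] R by (metis L Zc mult_carrier_mat)
  have Yc: "?c Y \<in> carrier_mat ?k d" using Y(1) by simp
  have Tc: "?c T \<in> carrier_mat l n" using T by simp
  have "?c D = ?Z * ?c Y"
    unfolding Y(2) by (rule of_real_hom.mat_hom_mult[OF basis_matrix_carrier Y(1)])
  then have "?c T * R * ?c D = ?c T * R * ?Z * ?c Y"
    using assoc_mult_mat[OF mult_carrier_mat[OF Tc R] Zc Yc] by simp
  also have "?c T * R * ?Z = ?c T * (?Z * W)"
    unfolding W(2)[symmetric] by (rule assoc_mult_mat[OF Tc R Zc])
  also have "\<dots> = ?c T * ?Z * W" by (rule assoc_mult_mat[symmetric, OF Tc Zc W(1)])
  also have "?c T * ?Z = ?c (T * basis_matrix n \<Z>)"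
    by (rule of_real_hom.mat_hom_mult[symmetric, OF T basis_matrix_carrier])
  also have "\<dots> = 0\<^sub>m l ?k" unfolding TZ by (rule eq_matI) auto
  finally show "?c T * R * ?c D = 0\<^sub>m (dim_row T) (dim_col D)"
    using W(1) Yc T D by simp
qed

theorem theorem9:
  fixes n :: nat and \<E> :: "(nat \<times> nat) set" and \<B> \<C> \<D> \<T> :: "nat set"
    and A B D T :: "real mat"
  assumes digraph: "weighted_digraph n \<E> A"
    and nodes: "\<B> \<subseteq> {..<n}" "\<C> \<subseteq> {..<n}" "\<D> \<subseteq> {..<n}" "\<T> \<subseteq> {..<n}"
    and B: "B = basis_matrix n \<B>"
    and D: "D = basis_matrix n \<D>"
    and T: "T = (basis_matrix n \<T>)\<^sup>T"
    and disjoint: "\<D> \<inter> \<T> = {}" "\<D> \<inter> \<B> = {}" "\<T> \<inter> \<C> = {}"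
  shows
    "(\<forall>\<Z> \<subseteq> {..<n}. controlled_invariant n A \<B> \<Z> \<longrightarrow>
        (let Z = basis_matrix n \<Z>; Zp = basis_matrix n ({..<n} - \<Z>) in
          (\<exists>U \<in> carrier_mat (card \<B>) (card \<Z>). \<exists>X \<in> carrier_mat (card \<Z>) (card \<Z>).
             A * Z = Z * X + B * U) \<and>
          (\<forall>U \<in> carrier_mat (card \<B>) (card \<Z>). \<forall>M \<in> carrier_mat (card \<B>) (n - card \<Z>).
             (\<exists>X \<in> carrier_mat (card \<Z>) (card \<Z>). A * Z = Z * X + B * U) \<longrightarrow>
             friend n A \<B> \<Z> (U * Z\<^sup>T + M * Zp\<^sup>T) \<and>
             (\<D> \<subseteq> \<Z> \<and> \<Z> \<subseteq> {..<n} - \<T> \<longrightarrow>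
                solves_DDPSF A B D T (U * Z\<^sup>T + M * Zp\<^sup>T) \<and>
                solves_DDPSF_freq A B D T (U * Z\<^sup>T + M * Zp\<^sup>T))))) \<and>
     (\<B> = out_boundary n \<E> (max_invariant n \<E> \<T> \<B>) \<longrightarrow>
        (let \<Z> = max_invariant n \<E> \<T> \<B>; Zp = basis_matrix n ({..<n} - \<Z>) in
          \<forall>F. friend n A \<B> \<Z> F \<longleftrightarrow>
            (\<exists>M \<in> carrier_mat (card \<B>) (n - card \<Z>). F = B\<^sup>T * A + M * Zp\<^sup>T)))"
proof -
  have A: "A \<in> carrier_mat n n" using digraph by (simp add: weighted_digraph_def)
  have friend_and_decoupling: "let Z = basis_matrix n \<Z>; Zp = basis_matrix n ({..<n} - \<Z>) in
      (\<exists>U \<in> carrier_mat (card \<B>) (card \<Z>). \<exists>X \<in> carrier_mat (card \<Z>) (card \<Z>).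
         A * Z = Z * X + B * U) \<and>
      (\<forall>U \<in> carrier_mat (card \<B>) (card \<Z>). \<forall>M \<in> carrier_mat (card \<B>) (n - card \<Z>).
         (\<exists>X \<in> carrier_mat (card \<Z>) (card \<Z>). A * Z = Z * X + B * U) \<longrightarrow>
         friend n A \<B> \<Z> (U * Z\<^sup>T + M * Zp\<^sup>T) \<and>
         (\<D> \<subseteq> \<Z> \<and> \<Z> \<subseteq> {..<n} - \<T> \<longrightarrow>
            solves_DDPSF A B D T (U * Z\<^sup>T + M * Zp\<^sup>T) \<and>
            solves_DDPSF_freq A B D T (U * Z\<^sup>T + M * Zp\<^sup>T)))"
    if Z: "\<Z> \<subseteq> {..<n}" and inv: "controlled_invariant n A \<B> \<Z>" for \<Z>
    unfolding Let_def
  proof (intro conjI ballI impI)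
    let ?Z = "basis_matrix n \<Z>"
    show "\<exists>U\<in>carrier_mat (card \<B>) (card \<Z>). \<exists>X\<in>carrier_mat (card \<Z>) (card \<Z>).
        A * ?Z = ?Z * X + B * U"
      unfolding B by (rule controlled_invariant_factorization[OF Z nodes(1) A inv])
    fix U M :: "real mat"
    assume U: "U \<in> carrier_mat (card \<B>) (card \<Z>)" and M: "M \<in> carrier_mat (card \<B>) (n - card \<Z>)"
      and ex: "\<exists>X\<in>carrier_mat (card \<Z>) (card \<Z>). A * ?Z = ?Z * X + B * U"
    let ?F = "U * ?Z\<^sup>T + M * (basis_matrix n ({..<n} - \<Z>))\<^sup>T"
    show fr: "friend n A \<B> \<Z> ?F"
      using ex friend_of_factorization[OF Z A U M] unfolding B by blast
    then have F: "?F \<in> carrier_mat (card \<B>) n" by (simp add: friend_def)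
    obtain X where X: "X \<in> carrier_mat (card \<Z>) (card \<Z>)" "(A - B * ?F) * ?Z = ?Z * X"
      using fr unfolding friend_iff[OF Z A F] B by blast
    assume incl: "\<D> \<subseteq> \<Z> \<and> \<Z> \<subseteq> {..<n} - \<T>"
    have Bc: "B \<in> carrier_mat n (card \<B>)" and Dc: "D \<in> carrier_mat n (card \<D>)"
      and Tc: "T \<in> carrier_mat (card \<T>) n" by (simp_all add: B D T)
    have "\<forall>i<n. i \<notin> \<Z> \<longrightarrow> (\<forall>k<card \<D>. D $$ (i, k) = 0)"
    proof (intro allI impI)
      fix i k assume i: "i < n" "i \<notin> \<Z>" and k: "k < card \<D>"
      \<comment> \<open>\<open>D\<close> is itself a basis matrix, so it factors through the one of \<open>\<D>\<close> with cofactor \<open>I\<close>.\<close>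
      have "D = D * 1\<^sub>m (card \<D>)" using Dc by simp
      then have "\<forall>i<n. i \<notin> \<D> \<longrightarrow> (\<forall>k<card \<D>. D $$ (i, k) = 0)"
        using mat_supported_iff[OF nodes(3) Dc] unfolding D by (metis one_carrier_mat)
      then show "D $$ (i, k) = 0" using i k incl by blast
    qed
    then obtain Y where Y: "Y \<in> carrier_mat (card \<Z>) (card \<D>)" "D = ?Z * Y"
      using mat_supported_iff[OF Z Dc] by blast
    have TZ: "T * ?Z = 0\<^sub>m (card \<T>) (card \<Z>)"
      unfolding T using incl by (intro basis_matrix_orthogonal[OF nodes(4) Z]) blast
    show "solves_DDPSF A B D T ?F"
      by (rule invariant_subspace_solves_DDPSF[OF Z A Bc F Dc Tc X Y TZ])
    show "solves_DDPSF_freq A B D T ?F"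
      by (rule invariant_subspace_solves_DDPSF_freq[OF Z A Bc F Dc Tc X Y TZ])
  qed
  have "max_invariant n \<E> \<T> \<B> \<subseteq> invariant_iter n \<E> \<T> \<B> 0"
    unfolding max_invariant_def by blast
  then have Zmax: "max_invariant n \<E> \<T> \<B> \<subseteq> {..<n}" by auto
  show ?thesis
    using friend_and_decoupling friend_out_boundary_iff[OF digraph Zmax] unfolding Let_def B by blast
qed

end
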